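(* Let $P_1,P_2\subseteq\mathbb{R}_{\max}^n$ be non-empty compact tropical polyhedra, let $f:\mathbb{R}_{\max}^n\times\mathbb{R}_{\max}^n\to\mathbb{R}_{\max}$ be continuous, and let $\operatorname{opt}$ stand for either $\min$ or $\max$ (fixed throughout). Consider the bilevel problem $$\operatorname{opt}_{x,y}\ f(x,y)\quad\text{s.t.}\quad x\in P_1,\ \ y\in\arg\min_{y'}\{x^Ty' : y'\in P_2\}.\qquad(\ast)$$ Let $\mathcal{S}$ be a min-essential subset of $P_2$ and suppose that $\mathcal{S}$ is finite. Then the generalized Dempe-Franke algorithm (described in the context), run with $\mathcal{S}$, terminates in a finite number of steps and results in a globally optimal solution of $(\ast)$.
   Context: $\mathbb{R}_{\max}=\mathbb{R}\cup\{-\infty\}$ with $a\oplus b=\max(a,b)$ and $a\otimes b=a+b$ (with $-\infty+a=-\infty$ for all $a$). For $x,y\in\mathbb{R}_{\max}^n$, $x^Ty$ denotes the tropical scalar product $\max_{1\le i\le n}(x_i+y_i)$. A tropical polyhedron in $\mathbb{R}_{\max}^n$ is an intersection of finitely many tropical affine halfspaces, i.e. sets of the form $\{x\in\mathbb{R}_{\max}^n : a^Tx\oplus\alpha\le b^Tx\oplus\beta\}$ with $a,b\in\mathbb{R}_{\max}^n$, $\alpha,\beta\in\mathbb{R}_{\max}$. Topology: $\mathbb{R}_{\max}^n$ carries the metric $\rho(x,y)=\max_i|e^{x_i}-e^{y_i}|$ (with $e^{-\infty}=0$); compactness and continuity (both for the domain and for the codomain $\mathbb{R}_{\max}$, i.e.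 $e^{f}$ is continuous) are with respect to this topology. Min-essential subset: $\mathcal{S}\subseteq P$ is a min-essential subset of a tropical polyhedron $P$ if for every $x\in\mathbb{R}_{\max}^n$ the minimum $\min_z\{x^Tz : z\in P\}$ is attained at a point of $\mathcal{S}$. Generalized Dempe-Franke algorithm: 1. Initial step. Find a pair $(x^0,y^0)$ solving $\operatorname{opt}_{x,y} f(x,y)$ s.t. $x\in P_1$, $y\in P_2$. If $y^0\in\arg\min_{y'}\{(x^0)^Ty' : y'\in P_2\}$, stop and return $(x^0,y^0)$. Otherwise find a point $z^0\in\mathcal{S}$ attaining $\min_{y'}\{(x^0)^Ty' : y'\in P_2\}$ and set $\mathcal{Z}^{(0)}=\{z^0\}$. 2. General step, for $k=1,2,\dots$. Find a pair $(x^k,y^k)$ solving $\operatorname{opt}_{x,y} f(x,y)$ s.t. $x\in P_1$, $y\in P_2$, $x^Ty\le\min_{z\in\mathcal{Z}^{(k-1)}}x^Tz$. If $y^k\in\arg\min_{y'}\{(x^k)^Ty' : y'\in P_2\}$, stop and return $(x^k,y^k)$. Otherwise find a point $z^k\in\mathcal{S}$ attaining $\min_{y'}\{(x^k)^Ty' : y'\in P_2\}$, set $\mathcal{Z}^{(k)}=\mathcal{Z}^{(k-1)}\cup\{z^k\}$, and repeat this step with $k:=k+1$. The choices of optimal solutions $(x^k,y^k)$ and of points $z^k$ are arbitrary. *)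

theory Defs
  imports "HOL-Analysis.Analysis"
begin

section \<open>The max-plus semiring\<close>

text \<open>The tropical sum is \<open>max\<close> of the order inherited from \<open>ereal\<close>; the tropical product
  is written \<open>+\<close> and satisfies \<open>-\<infinity> + a = -\<infinity>\<close>, as in \<open>ereal\<close>.\<close>

typedef rmax = "{x :: ereal. x \<noteq> \<infinity>}"
  by (rule exI[of _ 0]) simp

setup_lifting type_definition_rmax

instantiation rmax :: linorder
begin

lift_definition less_eq_rmax :: "rmax \<Rightarrow> rmax \<Rightarrow> bool" is "(\<le>)" .
lift_definition less_rmax :: "rmax \<Rightarrow> rmax \<Rightarrow> bool" is "(<)" .

instance
proof
  fix x y z :: rmax
  show "x < y \<longleftrightarrow> x \<le> y \<and> \<not> y \<le> x" by transfer (rule less_le_not_le)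
  show "x \<le> x" by transfer (rule order_refl)
  show "x \<le> y \<Longrightarrow> y \<le> z \<Longrightarrow> x \<le> z" by transfer (rule order_trans)
  show "x \<le> y \<Longrightarrow> y \<le> x \<Longrightarrow> x = y" by transfer (rule antisym)
  show "x \<le> y \<or> y \<le> x" by transfer (rule linear)
qed

end

instantiation rmax :: ordered_ab_semigroup_add
begin

lift_definition plus_rmax :: "rmax \<Rightarrow> rmax \<Rightarrow> rmax" is "(+)"
  by simp

instance
proof
  fix a b c :: rmax
  show "a + b + c = a + (b + c)" by transfer (rule add.assoc)
  show "a + b = b + a" by transfer (rule add.commute)
  show "a \<le> b \<Longrightarrow> c + a \<le> c + b" by transfer (rule add_left_mono)
qed

end

instantiation rmax :: order_bot
begin

lift_definition bot_rmax :: rmax is "-\<infinity>"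
  by simp

instance
proof
  fix a :: rmax
  show "bot \<le> a" by transfer simp
qed

end

lift_definition rmax_of_real :: "real \<Rightarrow> rmax" is ereal
  by simp

lemma rmax_cases: obtains (bot) "x = bot" | (real) r where "x = rmax_of_real r"
proof -
  have "x = bot \<or> (\<exists>r. x = rmax_of_real r)"
    by transfer (metis ereal_cases)
  with that show ?thesis by blast
qed

lift_definition rexp :: "rmax \<Rightarrow> real" is
  "\<lambda>x. if x = -\<infinity> then 0 else exp (real_of_ereal x)" .

lemma rexp_simps [simp]: "rexp bot = 0" "rexp (rmax_of_real r) = exp r"
  by (transfer; simp)+

lemma rexp_inject: "rexp x = rexp y \<longleftrightarrow> x = y"
proof transfer
  show "(if x = - \<infinity> then 0 else exp (real_of_ereal x)) =
      (if y = - \<infinity> then 0 else exp (real_of_ereal y)) \<longleftrightarrow> x = y"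
    if "x \<noteq> \<infinity>" "y \<noteq> \<infinity>" for x y
    using that by (cases x; cases y) auto
qed


section \<open>Topology\<close>

instantiation rmax :: metric_space
begin

definition dist_rmax :: "rmax \<Rightarrow> rmax \<Rightarrow> real" where
  "dist_rmax x y = \<bar>rexp x - rexp y\<bar>"

definition uniformity_rmax :: "(rmax \<times> rmax) filter" where
  "uniformity_rmax = (INF e\<in>{0<..}. principal {(x, y). dist x y < e})"

definition open_rmax :: "rmax set \<Rightarrow> bool" where
  "open_rmax U = (\<forall>x\<in>U. eventually (\<lambda>(x', y). x' = x \<longrightarrow> y \<in> U) uniformity)"

instance
proof
  fix x y z :: rmax
  show "dist x y = 0 \<longleftrightarrow> x = y"
    by (simp add: dist_rmax_def rexp_inject)
  show "dist x y \<le> dist x z + dist y z"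
    unfolding dist_rmax_def by linarith
qed (simp_all only: uniformity_rmax_def open_rmax_def)

end

definition rho :: "rmax ^ 'n \<Rightarrow> rmax ^ 'n \<Rightarrow> real" where
  "rho x y = (MAX i. \<bar>rexp (x $ i) - rexp (y $ i)\<bar>)"

text \<open>The library metric on \<open>rmax ^ 'n\<close> is the Euclidean combination of the coordinate
  distances rather than \<open>rho\<close>, but it induces the same topology, so that \<open>compact\<close> and
  \<open>continuous_on\<close> below do refer to the topology of \<open>rho\<close>.\<close>

lemma rho_le_dist: "rho x y \<le> dist x y"
  unfolding rho_def
  by (rule Max.boundedI) (auto simp flip: dist_rmax_def intro: dist_vec_nth_le)

lemma dist_nth_le_rho: "dist (x $ i) (y $ i) \<le> rho x y"
  unfolding rho_def dist_rmax_def by (rule Max_ge) auto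

lemma dist_le_rho: "dist x y \<le> real CARD('n) * rho x y" for x y :: "rmax ^ 'n"
proof -
  have "dist x y \<le> (\<Sum>i\<in>UNIV. dist (x $ i) (y $ i))"
    unfolding dist_vec_def by (rule L2_set_le_sum) simp
  also have "\<dots> \<le> (\<Sum>i\<in>(UNIV :: 'n set). rho x y)"
    by (intro sum_mono dist_nth_le_rho)
  finally show ?thesis by simp
qed

lemma Metric_space_rho: "Metric_space UNIV (rho :: rmax ^ 'n \<Rightarrow> rmax ^ 'n \<Rightarrow> real)"
proof
  fix x y z :: "rmax ^ 'n"
  show "0 \<le> rho x y"
    by (rule order_trans[OF zero_le_dist dist_nth_le_rho])
  show "rho x y = rho y x"
    by (simp add: rho_def abs_minus_commute)
  show "rho x y = 0 \<longleftrightarrow> x = y"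
  proof
    assume "rho x y = 0"
    with dist_le_rho[of x y] show "x = y" by simp
  next
    assume "x = y"
    then show "rho x y = 0"
      using rho_le_dist[of x y] \<open>0 \<le> rho x y\<close> by simp
  qed
  show "rho x z \<le> rho x y + rho y z"
  proof -
    have "\<bar>rexp (x $ i) - rexp (z $ i)\<bar> \<le> rho x y + rho y z" for i
      using dist_triangle[of "x $ i" "z $ i" "y $ i"]
        dist_nth_le_rho[of x i y] dist_nth_le_rho[of y i z]
      by (simp add: dist_rmax_def)
    then show ?thesis
      unfolding rho_def[of x z] by (intro Max.boundedI) auto
  qed
qed

lemma mtopology_rho_eq_euclidean:
  "Metric_space.mtopology UNIV (rho :: rmax ^ 'n \<Rightarrow> rmax ^ 'n \<Rightarrow> real) = euclidean"
proof -
  interpret Metric_space UNIV "rho :: rmax ^ 'n \<Rightarrow> rmax ^ 'n \<Rightarrow> real"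
    by (rule Metric_space_rho)
  have "openin mtopology U \<longleftrightarrow> open U" for U :: "(rmax ^ 'n) set"
  proof
    assume U: "openin mtopology U"
    show "open U"
      unfolding open_dist
    proof
      fix x assume "x \<in> U"
      with U obtain r where r: "r > 0" "mball x r \<subseteq> U"
        by (auto simp: openin_mtopology)
      have "y \<in> U" if "dist y x < r" for y
      proof -
        have "rho x y < r"
          using that rho_le_dist[of x y] by (simp add: dist_commute[of y x])
        then have "y \<in> mball x r" by simp
        with r show ?thesis by blast
      qed
      with r show "\<exists>e>0. \<forall>y. dist y x < e \<longrightarrow> y \<in> U" by blast
    qed
  next
    assume U: "open U"
    show "openin mtopology U"
      unfolding openin_mtopology
    proof (intro conjI allI impI)
      fix x assume "x \<in> U"
      with U obtain e where e: "e > 0" "\<And>y. dist y x < e \<Longrightarrow> y \<in> U"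
        by (auto simp: open_dist)
      define r where "r = e / real CARD('n)"
      have "r > 0" using e by (simp add: r_def)
      moreover have "y \<in> U" if "rho x y < r" for y
      proof (rule e(2))
        have "real CARD('n) * rho x y < e"
          using that by (simp add: r_def field_simps)
        with dist_le_rho[of x y] show "dist y x < e" by (simp add: dist_commute[of y x])
      qed
      ultimately have "r > 0 \<and> mball x r \<subseteq> U"
        by (simp add: subset_iff)
      then show "\<exists>r>0. mball x r \<subseteq> U" by blast
    qed simp
  qed
  then show ?thesis
    by (simp add: topology_eq)
qed


section \<open>Tropical polyhedra\<close>

definition tdot :: "rmax ^ 'n \<Rightarrow> rmax ^ 'n \<Rightarrow> rmax" where
  "tdot x y = (MAX i. x $ i + y $ i)"

definition tropical_halfspace :: "(rmax ^ 'n) set \<Rightarrow> bool" where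
  "tropical_halfspace H \<longleftrightarrow>
    (\<exists>a b \<alpha> \<beta>. H = {x. max (tdot a x) \<alpha> \<le> max (tdot b x) \<beta>})"

definition tropical_polyhedron :: "(rmax ^ 'n) set \<Rightarrow> bool" where
  "tropical_polyhedron P \<longleftrightarrow>
    (\<exists>\<H>. finite \<H> \<and> (\<forall>H\<in>\<H>. tropical_halfspace H) \<and> P = \<Inter>\<H>)"


section \<open>The bilevel problem\<close>

datatype opt_sense = Minimize | Maximize

fun is_optimal :: "opt_sense \<Rightarrow> ('a \<Rightarrow> 'b::order) \<Rightarrow> 'a set \<Rightarrow> 'a \<Rightarrow> bool" where
  "is_optimal Minimize f A p = is_arg_min f (\<lambda>q. q \<in> A) p"
| "is_optimal Maximize f A p = is_arg_max f (\<lambda>q. q \<in> A) p"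

definition lower_argmin :: "(rmax ^ 'n) set \<Rightarrow> rmax ^ 'n \<Rightarrow> (rmax ^ 'n) set" where
  "lower_argmin P x = {y. is_arg_min (tdot x) (\<lambda>y'. y' \<in> P) y}"

definition bilevel_feasible ::
  "(rmax ^ 'n) set \<Rightarrow> (rmax ^ 'n) set \<Rightarrow> ((rmax ^ 'n) \<times> (rmax ^ 'n)) set" where
  "bilevel_feasible P1 P2 = {(x, y). x \<in> P1 \<and> y \<in> lower_argmin P2 x}"

definition min_essential :: "(rmax ^ 'n) set \<Rightarrow> (rmax ^ 'n) set \<Rightarrow> bool" where
  "min_essential S P \<longleftrightarrow> S \<subseteq> P \<and> (\<forall>x. \<exists>z\<in>S. z \<in> lower_argmin P x)"


section \<open>The generalized Dempe-Franke algorithm\<close>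

text \<open>The feasible set of the problem solved in one step. The initial step is the case
  \<open>Z = {}\<close>, in which the constraint involving \<open>Z\<close> is absent.\<close>

definition relaxed_feasible ::
  "(rmax ^ 'n) set \<Rightarrow> (rmax ^ 'n) set \<Rightarrow> (rmax ^ 'n) set \<Rightarrow> ((rmax ^ 'n) \<times> (rmax ^ 'n)) set" where
  "relaxed_feasible P1 P2 Z =
    {(x, y). x \<in> P1 \<and> y \<in> P2 \<and> (Z \<noteq> {} \<longrightarrow> tdot x y \<le> (MIN z\<in>Z. tdot x z))}"

text \<open>\<open>Solve Z\<close>: about to solve the problem with cut set \<open>Z\<close>; \<open>Solved Z x y\<close>: the pair
  \<open>(x, y)\<close> has been found; \<open>Returned x y\<close>: the algorithm has stopped with this result.
  One step of the algorithm consists of two transitions. They are separated because the choices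
  of \<open>(x, y)\<close> and of \<open>z\<close> are both arbitrary: being able to continue from every reachable
  \<open>Solved Z x y\<close> means that no choice of \<open>(x, y)\<close> leads to a dead end.\<close>

datatype 'n df_state =
    Solve "(rmax ^ 'n) set"
  | Solved "(rmax ^ 'n) set" "rmax ^ 'n" "rmax ^ 'n"
  | Returned "rmax ^ 'n" "rmax ^ 'n"

inductive df_step ::
  "opt_sense \<Rightarrow> ((rmax ^ 'n) \<times> (rmax ^ 'n) \<Rightarrow> rmax) \<Rightarrow> (rmax ^ 'n) set \<Rightarrow> (rmax ^ 'n) set \<Rightarrow>
    (rmax ^ 'n) set \<Rightarrow> 'n df_state \<Rightarrow> 'n df_state \<Rightarrow> bool"
  for opt f P1 P2 S where
  solve: "is_optimal opt f (relaxed_feasible P1 P2 Z) (x, y) \<Longrightarrow>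
    df_step opt f P1 P2 S (Solve Z) (Solved Z x y)"
| stop: "y \<in> lower_argmin P2 x \<Longrightarrow>
    df_step opt f P1 P2 S (Solved Z x y) (Returned x y)"
| cut: "y \<notin> lower_argmin P2 x \<Longrightarrow> z \<in> S \<Longrightarrow> z \<in> lower_argmin P2 x \<Longrightarrow>
    df_step opt f P1 P2 S (Solved Z x y) (Solve (insert z Z))"

abbreviation df_reachable where
  "df_reachable opt f P1 P2 S \<equiv> (df_step opt f P1 P2 S)\<^sup>*\<^sup>* (Solve {})"

end

theory Submission
  imports Defs
begin

text \<open>A cut point found in a step is not yet in the cut set, since otherwise the constraint that it
  imposes would already make the computed \<open>y\<close> optimal for the lower level. As all cut points come
  from the finite set \<open>S\<close>, every run is finite. A solution of a step exists because \<open>rexp\<close> turns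
  the cut constraints into finitely many polynomial inequalities, so the feasible sets are compact.
  They all contain the bilevel feasible set, so a returned pair, being optimal on one of them and
  bilevel feasible, is optimal for the bilevel problem.\<close>

lemma rexp_less_iff: "rexp a < rexp b \<longleftrightarrow> a < b"
proof transfer
  show "(if a = - \<infinity> then 0 else exp (real_of_ereal a)) <
      (if b = - \<infinity> then 0 else exp (real_of_ereal b)) \<longleftrightarrow> a < b"
    if "a \<noteq> \<infinity>" "b \<noteq> \<infinity>" for a b
    using that by (cases a; cases b) (auto simp: not_less)
qed

lemma rexp_le_iff: "rexp a \<le> rexp b \<longleftrightarrow> a \<le> b"
  by (simp flip: not_less add: rexp_less_iff)

lemma rexp_add: "rexp (a + b) = rexp a * rexp b"
proof transfer
  show "(if a + b = - \<infinity> then 0 else exp (real_of_ereal (a + b))) =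
      (if a = - \<infinity> then 0 else exp (real_of_ereal a)) *
      (if b = - \<infinity> then 0 else exp (real_of_ereal b))"
    if "a \<noteq> \<infinity>" "b \<noteq> \<infinity>" for a b
    using that by (cases a; cases b) (auto simp: exp_add)
qed

text \<open>The metric on \<open>rmax\<close> is the real distance pulled back along
  \<open>rexp\<close>, so \<open>rexp\<close> is an isometric embedding.\<close>

lemma continuous_on_rexp [continuous_intros]:
  assumes "continuous_on A f"
  shows "continuous_on A (\<lambda>x. rexp (f x))"
proof -
  have "continuous_on UNIV rexp"
    by (auto simp: continuous_on_iff dist_rmax_def dist_real_def)
  then show ?thesis
    using assms by (rule continuous_on_compose2) auto
qed

text \<open>One maximum is below another iff each term of the first is below some term of the
  second; \<open>rexp\<close> then turns tropical products into real ones. This form exposes the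
  comparison as a finite combination of continuous real inequalities.\<close>

lemma tdot_le_iff:
  "tdot x y \<le> tdot x z \<longleftrightarrow>
    (\<forall>i. \<exists>j. rexp (x $ i) * rexp (y $ i) \<le> rexp (x $ j) * rexp (z $ j))"
proof -
  have upper: "tdot x y \<le> t \<longleftrightarrow> (\<forall>i. x $ i + y $ i \<le> t)" for t
    unfolding tdot_def by (subst Max_le_iff) auto
  have lower: "t \<le> tdot x z \<longleftrightarrow> (\<exists>j. t \<le> x $ j + z $ j)" for t
    unfolding tdot_def by (subst Max_ge_iff) auto
  show ?thesis
    unfolding upper by (simp only: lower rexp_le_iff flip: rexp_add)
qed

lemma closed_cut: "closed {(x, y). tdot x y \<le> tdot x z}"
proof -
  have "{(x, y). tdot x y \<le> tdot x z} = (\<Inter>i. \<Union>j.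
      {p. rexp (fst p $ i) * rexp (snd p $ i) \<le> rexp (fst p $ j) * rexp (z $ j)})"
    by (auto simp: tdot_le_iff)
  also have "closed \<dots>"
    \<comment> \<open>The union over \<open>j\<close> stays closed because the index type is
      finite.\<close>
    by (intro closed_INT closed_UN ballI finite closed_Collect_le continuous_intros)
  finally show ?thesis .
qed

text \<open>Since \<open>rexp\<close> is strictly increasing, \<open>f\<close> and the real function
  \<open>rexp (f p)\<close> have the same optimizers, and the extreme value theorem applies to the
  latter.\<close>

lemma compact_has_optimal:
  fixes f :: "'a::topological_space \<Rightarrow> rmax"
  assumes "compact A" "A \<noteq> {}" "continuous_on A f"
  shows "\<exists>p. is_optimal opt f A p"
proof -
  have cont: "continuous_on A (\<lambda>p. rexp (f p))"
    by (intro continuous_intros assms)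
  show ?thesis
  proof (cases opt)
    case Minimize
    then show ?thesis
      using continuous_attains_inf[OF assms(1,2) cont]
      by (auto simp: is_arg_min_linorder rexp_le_iff)
  next
    case Maximize
    then show ?thesis
      using continuous_attains_sup[OF assms(1,2) cont]
      by (auto simp: is_arg_max_linorder rexp_le_iff)
  qed
qed

lemma is_optimal_mem: "is_optimal opt f A p \<Longrightarrow> p \<in> A"
  by (cases opt) (auto simp: is_arg_min_def is_arg_max_def)

lemma is_optimal_subset: "is_optimal opt f A p \<Longrightarrow> B \<subseteq> A \<Longrightarrow> p \<in> B \<Longrightarrow> is_optimal opt f B p"
  by (cases opt) (auto simp: is_arg_min_def is_arg_max_def)

lemma lower_argmin_iff: "y \<in> lower_argmin P x \<longleftrightarrow> y \<in> P \<and> (\<forall>z\<in>P. tdot x y \<le> tdot x z)"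
  by (auto simp: lower_argmin_def is_arg_min_linorder)

text \<open>With a bounded quantifier in place of \<open>MIN\<close>, the empty cut set of the
  initial step is no longer a special case.\<close>

lemma relaxed_feasible_iff:
  assumes "finite Z"
  shows "(x, y) \<in> relaxed_feasible P1 P2 Z \<longleftrightarrow>
    x \<in> P1 \<and> y \<in> P2 \<and> (\<forall>z\<in>Z. tdot x y \<le> tdot x z)"
  using assms by (auto simp: relaxed_feasible_def)

lemma bilevel_feasible_subset_relaxed_feasible:
  assumes "finite Z" "Z \<subseteq> P2"
  shows "bilevel_feasible P1 P2 \<subseteq> relaxed_feasible P1 P2 Z"
  using assms(2) unfolding bilevel_feasible_def
  by (clarsimp simp: relaxed_feasible_iff[OF assms(1)] lower_argmin_iff) blast

lemma compact_relaxed_feasible: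
  assumes "finite Z" "compact P1" "compact P2"
  shows "compact (relaxed_feasible P1 P2 Z)"
proof -
  have "relaxed_feasible P1 P2 Z = (P1 \<times> P2) \<inter> (\<Inter>z\<in>Z. {(x, y). tdot x y \<le> tdot x z})"
    using assms(1) by (auto simp: relaxed_feasible_iff)
  then show ?thesis
    using assms by (auto intro!: compact_Times closed_cut)
qed

lemma cut_point_new:
  assumes "finite Z" "(x, y) \<in> relaxed_feasible P1 P2 Z" "y \<notin> lower_argmin P2 x"
    "z \<in> lower_argmin P2 x"
  shows "z \<notin> Z"
  using assms by (meson lower_argmin_iff order_trans relaxed_feasible_iff)

context
  fixes opt :: opt_sense and f :: "(rmax ^ 'n) \<times> (rmax ^ 'n) \<Rightarrow> rmax"
    and P1 P2 S :: "(rmax ^ 'n) set"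
begin

text \<open>\<open>Z \<subseteq> S\<close> keeps \<open>Z\<close> finite and inside
  \<open>P2\<close>. Optimality is recorded at \<open>Solved\<close> because \<open>stop\<close>
  passes it on to the result and \<open>cut\<close> needs the feasibility it contains.\<close>

fun df_invariant :: "'n df_state \<Rightarrow> bool" where
  "df_invariant (Solve Z) \<longleftrightarrow> Z \<subseteq> S"
| "df_invariant (Solved Z x y) \<longleftrightarrow>
    Z \<subseteq> S \<and> is_optimal opt f (relaxed_feasible P1 P2 Z) (x, y)"
| "df_invariant (Returned x y) \<longleftrightarrow> is_optimal opt f (bilevel_feasible P1 P2) (x, y)"

text \<open>The factor 2 accounts for the two transitions per step: \<open>solve\<close> costs 1,
  and a new cut point lowers the cardinality by 1, which outweighs the return from offset 1 to
  offset 2.\<close>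

fun df_rank :: "'n df_state \<Rightarrow> nat" where
  "df_rank (Solve Z) = 2 * card (S - Z) + 2"
| "df_rank (Solved Z x y) = 2 * card (S - Z) + 1"
| "df_rank (Returned x y) = 0"

lemma df_invariant_step:
  assumes "S \<subseteq> P2" "finite S" "df_step opt f P1 P2 S c c'" "df_invariant c"
  shows "df_invariant c'"
  using assms(3,4)
proof cases
  case (stop y x Z)
  then have Z: "Z \<subseteq> S" and opt: "is_optimal opt f (relaxed_feasible P1 P2 Z) (x, y)"
    using assms(4) by auto
  have fin: "finite Z"
    using Z assms(2) by (rule finite_subset)
  have "(x, y) \<in> bilevel_feasible P1 P2"
    using is_optimal_mem[OF opt] stop fin by (simp add: bilevel_feasible_def relaxed_feasible_iff)
  moreover have "bilevel_feasible P1 P2 \<subseteq> relaxed_feasible P1 P2 Z"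
    using fin Z assms(1) by (intro bilevel_feasible_subset_relaxed_feasible) auto
  ultimately show ?thesis
    using is_optimal_subset[OF opt] stop by simp
qed auto

lemma df_rank_step:
  assumes "finite S" "df_step opt f P1 P2 S c c'" "df_invariant c"
  shows "df_rank c' < df_rank c"
  using assms(2,3)
proof cases
  case (cut y x z Z)
  then have Z: "Z \<subseteq> S" and opt: "is_optimal opt f (relaxed_feasible P1 P2 Z) (x, y)"
    using assms(3) by auto
  have "z \<notin> Z"
    using finite_subset[OF Z assms(1)] is_optimal_mem[OF opt] cut(3,5) by (rule cut_point_new)
  \<comment> \<open>The point \<open>z\<close> lies in \<open>S\<close> but not in \<open>Z\<close>,
    so it leaves the difference.\<close>
  then have "card (S - insert z Z) < card (S - Z)"
    using cut assms(1) by (intro psubset_card_mono) auto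
  then show ?thesis
    using cut by simp
qed auto

lemma df_invariant_reachable:
  assumes "S \<subseteq> P2" "finite S" "df_reachable opt f P1 P2 S c"
  shows "df_invariant c"
  using assms(3)
proof induction
  case (step c c')
  then show ?case
    using df_invariant_step[OF assms(1,2) step.hyps(2)] by simp
qed simp

lemma df_no_infinite_run:
  assumes "S \<subseteq> P2" "finite S" "\<sigma> 0 = Solve {}"
  shows "\<not> (\<forall>k :: nat. df_step opt f P1 P2 S (\<sigma> k) (\<sigma> (Suc k)))"
proof
  assume step: "\<forall>k. df_step opt f P1 P2 S (\<sigma> k) (\<sigma> (Suc k))"
  have "df_invariant (\<sigma> k)" for k
  proof (induction k)
    case (Suc k)
    then show ?case
      using df_invariant_step[OF assms(1,2) step[rule_format, of k]] by simp
  qed (simp add: assms(3))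
  then have "df_rank (\<sigma> (Suc k)) < df_rank (\<sigma> k)" for k
    using df_rank_step[OF assms(2) step[rule_format, of k]] by simp
  \<comment> \<open>The ranks along the run would form an infinite descending chain of
    naturals.\<close>
  then have "\<exists>r. \<forall>k. (r (Suc k), r k) \<in> less_than"
    by (intro exI[of _ "\<lambda>k. df_rank (\<sigma> k)"]) simp
  then show False
    using wf_less_than[unfolded wf_iff_no_infinite_down_chain] by (rule notE[rotated])
qed

text \<open>At \<open>Solve\<close> the relaxed set is compact, and nonempty because it contains a
  bilevel feasible pair: any \<open>x\<close> in \<open>P1\<close> with a lower-level minimizer from
  \<open>S\<close>. At \<open>Solved\<close> either \<open>y\<close> is such a minimizer or
  \<open>S\<close> supplies a cut point.\<close>

lemma df_progress:
  assumes "compact P1" "compact P2" "P1 \<noteq> {}" "continuous_on UNIV f"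
    "min_essential S P2" "finite S" "df_invariant c"
  shows "(\<exists>c'. df_step opt f P1 P2 S c c') \<or> (\<exists>x y. c = Returned x y)"
proof (cases c)
  case (Solve Z)
  then have Z: "Z \<subseteq> S"
    using assms(7) by simp
  have fin: "finite Z"
    using Z assms(6) by (rule finite_subset)
  obtain x where "x \<in> P1"
    using assms(3) by blast
  moreover obtain y where "y \<in> lower_argmin P2 x"
    using assms(5) by (auto simp: min_essential_def)
  ultimately have "bilevel_feasible P1 P2 \<noteq> {}"
    by (auto simp: bilevel_feasible_def)
  moreover have "bilevel_feasible P1 P2 \<subseteq> relaxed_feasible P1 P2 Z"
    using fin Z assms(5)
    by (intro bilevel_feasible_subset_relaxed_feasible) (auto simp: min_essential_def)
  ultimately have "relaxed_feasible P1 P2 Z \<noteq> {}"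
    by blast
  moreover have "continuous_on (relaxed_feasible P1 P2 Z) f"
    using assms(4) by (rule continuous_on_subset) simp
  ultimately obtain p where "is_optimal opt f (relaxed_feasible P1 P2 Z) p"
    using compact_has_optimal compact_relaxed_feasible[OF fin assms(1,2)] by blast
  then show ?thesis
    unfolding Solve by (cases p) (metis df_step.solve)
next
  case (Solved Z x y)
  obtain z where "z \<in> S" "z \<in> lower_argmin P2 x"
    using assms(5) by (auto simp: min_essential_def)
  then show ?thesis
    unfolding Solved by (metis df_step.stop df_step.cut)
qed simp

end

theorem theorem2p1:
  fixes P1 P2 S :: "(rmax ^ 'n) set"
    and f :: "(rmax ^ 'n) \<times> (rmax ^ 'n) \<Rightarrow> rmax"
    and opt :: opt_sense
  assumes "tropical_polyhedron P1" "P1 \<noteq> {}" "compact P1"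
    and "tropical_polyhedron P2" "P2 \<noteq> {}" "compact P2"
    and "continuous_on UNIV f"
    and "min_essential S P2" "finite S"
  shows
    \<comment> \<open>no run is infinite,\<close>
    "(\<nexists>\<sigma>. \<sigma> 0 = Solve {} \<and> (\<forall>k :: nat. df_step opt f P1 P2 S (\<sigma> k) (\<sigma> (Suc k)))) \<and>
     \<comment> \<open>no run gets stuck before returning a result,\<close>
     (\<forall>c. df_reachable opt f P1 P2 S c \<longrightarrow>
        (\<exists>c'. df_step opt f P1 P2 S c c') \<or> (\<exists>x y. c = Returned x y)) \<and>
     \<comment> \<open>and every returned result is globally optimal.\<close>
     (\<forall>x y. df_reachable opt f P1 P2 S (Returned x y) \<longrightarrow>
        is_optimal opt f (bilevel_feasible P1 P2) (x, y))"
proof -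
  have S: "S \<subseteq> P2"
    using assms(8) by (simp add: min_essential_def)
  have inv: "df_invariant opt f P1 P2 S c" if "df_reachable opt f P1 P2 S c" for c
    using S assms(9) that by (rule df_invariant_reachable)
  show ?thesis
  proof (intro conjI allI impI)
    show "\<nexists>\<sigma>. \<sigma> 0 = Solve {} \<and> (\<forall>k :: nat. df_step opt f P1 P2 S (\<sigma> k) (\<sigma> (Suc k)))"
      using df_no_infinite_run[OF S assms(9)] by blast
    show "(\<exists>c'. df_step opt f P1 P2 S c c') \<or> (\<exists>x y. c = Returned x y)"
      if "df_reachable opt f P1 P2 S c" for c
      using df_progress[OF assms(3,6,2,7-9) inv[OF that]] .
    \<comment> \<open>At a \<open>Returned\<close> state the invariant is exactly this
      claim.\<close>
    show "is_optimal opt f (bilevel_feasible P1 P2) (x, y)"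
      if "df_reachable opt f P1 P2 S (Returned x y)" for x y
      using inv[OF that] by simp
  qed
qed

end
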